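(* Let $n \ge 1$ and let $\Diamond^n = \{x \in \mathbb{R}^n : \|x\|_1 \le 1\}$. Let $T$ be a triangulation of $\Diamond^n$, and let $\lambda : V(T) \to \{-1,1\}^n$ be a label function with the property that for every vertex $x \in V(T)$ and every $v \in \{-1,1\}^n$, if $v^{T} x = 1$ then $\lambda(x) \neq -v$. Then $T$ contains a neutral simplex, i.e. a simplex $\sigma \in T$ such that for every $1 \le i \le n$ there exist vertices $v_1, v_2 \in V(\sigma)$ with $\lambda_i(v_1) = -1$ and $\lambda_i(v_2) = +1$, where $\lambda_i(v)$ denotes the $i$-th coordinate of $\lambda(v)$.
   Context: A $k$-simplex is the convex hull of $k+1$ affinely independent points (its vertices); its faces are convex hulls of subsets of its vertices. A triangulation of $X \subset \mathbb{R}^n$ is a finite family $T$ of simplices whose union is $X$, such that every face of a simplex in $T$ is in $T$, and the intersection of any two simplices of $T$ is a face of both. $V(T)$ is the set of vertices (0-simplices) of $T$. Note $\{-1,1\}^n$ is the set of extreme points of the cube $[-1,1]^n$. *)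

theory Defs
  imports "HOL-Analysis.Analysis"
begin

definition cross_polytope :: "(real ^ 'n) set" where
  "cross_polytope = {x. (\<Sum>i\<in>UNIV. \<bar>x $ i\<bar>) \<le> 1}"

definition sign_vectors :: "(real ^ 'n) set" where
  "sign_vectors = {v. \<forall>i. v $ i = -1 \<or> v $ i = 1}"

(* The constant triangulation of HOL-Analysis does not require closure under faces, so
   simplicial_complex is the notion needed here.  Faces of a simplex in the sense of face_of are
   exactly the convex hulls of subsets of its vertices (face_of_convex_hull_affine_independent);
   this includes the empty face. *)
definition triangulates :: "'a::euclidean_space set set \<Rightarrow> 'a set \<Rightarrow> bool"
    (infix \<open>triangulates\<close> 50) where
  "T triangulates X \<longleftrightarrow> simplicial_complex T \<and> \<Union>T = X"

definition complex_vertices :: "'a::euclidean_space set set \<Rightarrow> 'a set" where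
  "complex_vertices T = {x. {x} \<in> T}"

definition simplex_vertices :: "'a::euclidean_space set \<Rightarrow> 'a set" where
  "simplex_vertices S = {x. x extreme_point_of S}"

lemma simplex_vertices_convex_hull:
  "\<not> affine_dependent C \<Longrightarrow> simplex_vertices (convex hull C) = C"
  by (simp add: simplex_vertices_def extreme_point_of_convex_hull_affine_independent)

lemma simplex_vertices_subset:
  "T triangulates X \<Longrightarrow> S \<in> T \<Longrightarrow> simplex_vertices S \<subseteq> complex_vertices T"
  unfolding triangulates_def simplicial_complex_def simplex_vertices_def complex_vertices_def
  by (auto simp flip: face_of_singleton)

definition neutral :: "('a::euclidean_space \<Rightarrow> real ^ 'n) \<Rightarrow> 'a set \<Rightarrow> bool" where
  "neutral l S \<longleftrightarrow>
     (\<forall>i. \<exists>v1 \<in> simplex_vertices S. \<exists>v2 \<in> simplex_vertices S. l v1 $ i = -1 \<and> l v2 $ i = 1)"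

end

theory Submission
  imports Defs
begin

text \<open>
  Extend the labelling linearly over each simplex to a continuous map \<open>f\<close> into the cube
  $[-1,1]^n$.  If no simplex is neutral, then on every simplex some coordinate of \<open>f\<close> is
  constantly $\pm 1$, so \<open>f\<close> takes values in the boundary of the cube.  Shrinking
  every coordinate towards $0$ by $1 - 1/n$ and normalising in the $1$-norm therefore
  yields a map to the boundary of the cross polytope, and by Brouwer its negative has a fixed
  point \<open>x\<close>.  On the support \<open>A\<close> of \<open>x\<close>, each coordinate of
  $f(x)$ is then within $1/n$ of minus the sign of $x_i$.  But the boundary condition says that
  each vertex of the carrier of \<open>x\<close> has a label agreeing with the sign of \<open>x\<close>
  somewhere on \<open>A\<close>; averaging these labels shows that this is impossible.
\<close>

section \<open>Linear extension of vertex labels over a simplicial complex\<close>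

text \<open>Affine independence makes the differences from a base point \<open>a\<close> of
  \<open>C\<close> linearly independent, so a linear \<open>h\<close> can be prescribed on them;
  \<open>g\<close> is \<open>h\<close> translated. Only \<open>sum u C = 1\<close> matters, not the
  signs of \<open>u\<close>.\<close>

lemma affine_interpolation:
  fixes C :: "'a::euclidean_space set" and l :: "'a \<Rightarrow> 'b::real_normed_vector"
  assumes "\<not> affine_dependent C"
  obtains g where "continuous_on UNIV g"
    and "\<And>u. sum u C = 1 \<Longrightarrow> g (\<Sum>v\<in>C. u v *\<^sub>R v) = (\<Sum>v\<in>C. u v *\<^sub>R l v)"
proof (cases "C = {}")
  case True
  then show ?thesis
    \<comment> \<open>Over the empty set no \<open>u\<close> sums to 1, so any continuous map
      serves.\<close>
    using that[of "\<lambda>_. 0"] by simp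
next
  case False
  then obtain a where a: "a \<in> C" by blast
  have "independent ((\<lambda>x. - a + x) ` (C - {a}))"
    using assms a affine_dependent_iff_dependent2 by blast
  then obtain h where h: "linear h"
      "\<And>x. x \<in> (\<lambda>x. - a + x) ` (C - {a}) \<Longrightarrow> h x = l (a + x) - l a"
    using linear_independent_extend[of _ "\<lambda>x. l (a + x) - l a"] by blast
  have hC: "h (v - a) = l v - l a" if "v \<in> C" for v
    using h(2)[of "v - a"] that linear_0[OF h(1)] by (cases "v = a") auto
  show ?thesis
  proof (rule that)
    show "continuous_on UNIV (\<lambda>x. l a + h (x - a))"
      by (intro continuous_intros linear_continuous_on_compose[OF _ h(1)])
  next
    fix u :: "'a \<Rightarrow> real"
    assume u: "sum u C = 1"
    have "(\<Sum>v\<in>C. u v *\<^sub>R v) - a = (\<Sum>v\<in>C. u v *\<^sub>R (v - a))"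
      using u by (simp add: scaleR_right_diff_distrib sum_subtractf flip: scaleR_sum_left)
    then have "h ((\<Sum>v\<in>C. u v *\<^sub>R v) - a) = (\<Sum>v\<in>C. u v *\<^sub>R (l v - l a))"
      using h(1) by (simp add: linear_sum linear_cmul hC)
    also have "\<dots> = (\<Sum>v\<in>C. u v *\<^sub>R l v) - l a"
      using u by (simp add: scaleR_right_diff_distrib sum_subtractf flip: scaleR_sum_left)
    finally show "l a + h ((\<Sum>v\<in>C. u v *\<^sub>R v) - a) = (\<Sum>v\<in>C. u v *\<^sub>R l v)"
      by simp
  qed
qed

lemma simplicial_complex_simplex_vertices:
  assumes "simplicial_complex T" "S \<in> T"
  shows "\<not> affine_dependent (simplex_vertices S)" "S = convex hull simplex_vertices S"
proof -
  obtain n where "n simplex S"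
    using assms unfolding simplicial_complex_def by blast
  then obtain C where "\<not> affine_dependent C" "S = convex hull C"
    unfolding simplex_def by blast
  then show "\<not> affine_dependent (simplex_vertices S)" "S = convex hull simplex_vertices S"
    by (simp_all add: simplex_vertices_convex_hull)
qed

lemma simplex_convex_combination:
  assumes "simplicial_complex T" "S \<in> T" "x \<in> S"
  obtains u where "\<forall>v\<in>simplex_vertices S. 0 \<le> u v" "sum u (simplex_vertices S) = 1"
    "(\<Sum>v\<in>simplex_vertices S. u v *\<^sub>R v) = x"
proof -
  note simplicial_complex_simplex_vertices[OF assms(1,2)]
  then have "x \<in> convex hull simplex_vertices S" "finite (simplex_vertices S)"
    using assms(3) aff_independent_finite by auto
  then show thesis
    using that by (auto simp: convex_hull_finite)
qed

text \<open>The interpolant on a simplex depends only on the labels of its vertices, so interpolants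
  of two simplices agree on their common face; finitely many closed pieces then glue to a continuous
  map.\<close>

lemma simplicial_interpolation:
  fixes T :: "'a::euclidean_space set set" and l :: "'a \<Rightarrow> 'b::real_normed_vector"
  assumes T: "simplicial_complex T"
  obtains f where "continuous_on (\<Union>T) f"
    and "\<And>S u. S \<in> T \<Longrightarrow> \<forall>v\<in>simplex_vertices S. 0 \<le> u v \<Longrightarrow> sum u (simplex_vertices S) = 1 \<Longrightarrow>
           f (\<Sum>v\<in>simplex_vertices S. u v *\<^sub>R v) = (\<Sum>v\<in>simplex_vertices S. u v *\<^sub>R l v)"
proof -
  let ?V = simplex_vertices
  note indep = simplicial_complex_simplex_vertices(1)[OF T]
  note hull = simplicial_complex_simplex_vertices(2)[OF T]
  have fin: "finite (?V S)" if "S \<in> T" for S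
    using indep[OF that] aff_independent_finite by blast
  have "\<exists>g. continuous_on UNIV g \<and>
      (\<forall>u. sum u (?V S) = 1 \<longrightarrow> g (\<Sum>v\<in>?V S. u v *\<^sub>R v) = (\<Sum>v\<in>?V S. u v *\<^sub>R l v))" if "S \<in> T" for S
    using affine_interpolation[OF indep[OF that], of l] by metis
  then obtain g where gcont: "\<And>S. S \<in> T \<Longrightarrow> continuous_on UNIV (g S)"
    and g: "\<And>S u. S \<in> T \<Longrightarrow> sum u (?V S) = 1 \<Longrightarrow>
              g S (\<Sum>v\<in>?V S. u v *\<^sub>R v) = (\<Sum>v\<in>?V S. u v *\<^sub>R l v)"
    by metis
  have gface: "g S x = g F x" if F: "F face_of S" "S \<in> T" "x \<in> F" for S F x
  proof -
    have FT: "F \<in> T"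
      using T F unfolding simplicial_complex_def by blast
    have sub: "?V F \<subseteq> ?V S"
      using F(1) by (auto simp: simplex_vertices_def intro: face_of_trans simp flip: face_of_singleton)
    obtain u where u: "\<forall>v\<in>?V F. 0 \<le> u v" "sum u (?V F) = 1" "(\<Sum>v\<in>?V F. u v *\<^sub>R v) = x"
      using simplex_convex_combination[OF T FT F(3)] by metis
    \<comment> \<open>Barycentric coordinates in the face, extended by zero, are barycentric
      coordinates in \<open>S\<close>.\<close>
    define w where "w = (\<lambda>v. if v \<in> ?V F then u v else 0)"
    have [simp]: "?V S \<inter> ?V F = ?V F" using sub by blast
    have sumw: "(\<Sum>v\<in>?V S. w v *\<^sub>R p v) = (\<Sum>v\<in>?V F. u v *\<^sub>R p v)" for p :: "'a \<Rightarrow> 'c::real_vector"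
      unfolding w_def
      by (rule sum.mono_neutral_cong_right) (use fin F sub in auto)
    have "sum w (?V S) = 1"
      using u(2) sumw[of "\<lambda>_. 1::real"] by simp
    from g[OF F(2) this] g[OF FT u(2)] show ?thesis
      by (simp add: sumw u(3))
  qed
  have agree: "g S x = g S' x" if "S \<in> T" "S' \<in> T" "x \<in> S" "x \<in> S'" for S S' x
  proof -
    have "S \<inter> S' face_of S" "S \<inter> S' face_of S'"
      using T that unfolding simplicial_complex_def by (blast, metis Int_commute)
    then show ?thesis
      using gface[of "S \<inter> S'" S x] gface[of "S \<inter> S'" S' x] that by simp
  qed
  \<comment> \<open>By \<open>agree\<close>, the value does not depend on the simplex
    chosen.\<close>
  define f where "f x = g (SOME S. S \<in> T \<and> x \<in> S) x" for x
  have f_eq: "f x = g S x" if "S \<in> T" "x \<in> S" for S x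
    using someI[of "\<lambda>S. S \<in> T \<and> x \<in> S" S] that agree unfolding f_def by blast
  show ?thesis
  proof (rule that)
    have "continuous_on (\<Union>S\<in>T. S) f"
    proof (rule continuous_on_closed_Union)
      show "finite T" using T unfolding simplicial_complex_def by blast
      show "closed S" if "S \<in> T" for S
        using hull[OF that] fin[OF that]
        by (metis compact_imp_closed finite_imp_compact_convex_hull)
      show "continuous_on S f" if "S \<in> T" for S
        using continuous_on_subset[OF gcont[OF that]] f_eq[OF that]
        by (metis continuous_on_cong subset_UNIV)
    qed
    then show "continuous_on (\<Union>T) f" by simp
  next
    fix S and u :: "'a \<Rightarrow> real"
    assume S: "S \<in> T" and u: "\<forall>v\<in>?V S. 0 \<le> u v" "sum u (?V S) = 1"
    have "(\<Sum>v\<in>?V S. u v *\<^sub>R v) \<in> S"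
      using hull[OF S] convex_hull_finite[OF fin[OF S]] u by auto
    then show "f (\<Sum>v\<in>?V S. u v *\<^sub>R v) = (\<Sum>v\<in>?V S. u v *\<^sub>R l v)"
      using f_eq[OF S] g[OF S u(2)] by simp
  qed
qed

section \<open>Geometry of the cross polytope\<close>

lemma compact_cross_polytope: "compact (cross_polytope :: (real ^ 'n) set)"
proof -
  have "closed (cross_polytope :: (real ^ 'n) set)"
    unfolding cross_polytope_def by (intro closed_Collect_le continuous_intros)
  moreover have "norm x \<le> 1" if "x \<in> cross_polytope" for x :: "real ^ 'n"
    using norm_le_l1_cart[of x] that unfolding cross_polytope_def by simp
  ultimately show ?thesis
    by (auto simp: compact_eq_bounded_closed bounded_iff)
qed

lemma convex_cross_polytope: "convex (cross_polytope :: (real ^ 'n) set)"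
proof (rule convexI)
  fix x y :: "real ^ 'n" and a b :: real
  assume x: "x \<in> cross_polytope" and y: "y \<in> cross_polytope" and ab: "0 \<le> a" "0 \<le> b" "a + b = 1"
  have "(\<Sum>i\<in>UNIV. \<bar>(a *\<^sub>R x + b *\<^sub>R y) $ i\<bar>) \<le> (\<Sum>i\<in>UNIV. a * \<bar>x $ i\<bar> + b * \<bar>y $ i\<bar>)"
    using ab by (intro sum_mono) (auto intro!: order.trans[OF abs_triangle_ineq] simp: abs_mult)
  also have "\<dots> = a * (\<Sum>i\<in>UNIV. \<bar>x $ i\<bar>) + b * (\<Sum>i\<in>UNIV. \<bar>y $ i\<bar>)"
    by (simp add: sum.distrib sum_distrib_left)
  also have "\<dots> \<le> 1"
    using x y ab unfolding cross_polytope_def by (auto intro: convex_bound_le)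
  finally show "a *\<^sub>R x + b *\<^sub>R y \<in> cross_polytope"
    unfolding cross_polytope_def by simp
qed

lemma sign_vector_inner_le_1:
  assumes "v \<in> sign_vectors" "x \<in> cross_polytope"
  shows "v \<bullet> x \<le> 1"
proof -
  have "v $ i * x $ i \<le> \<bar>x $ i\<bar>" for i
    using assms(1) unfolding sign_vectors_def by (cases "v $ i = 1") (auto dest: spec[of _ i])
  then have "v \<bullet> x \<le> (\<Sum>i\<in>UNIV. \<bar>x $ i\<bar>)"
    by (simp add: inner_vec_def sum_mono)
  then show ?thesis
    using assms(2) unfolding cross_polytope_def by simp
qed

text \<open>The gaps \<open>b - p w\<close> are nonnegative with weighted sum 0, so each gap of
  positive weight vanishes. This carries \<open>v \<bullet> x = 1\<close> from a point to the
  vertices that support it.\<close>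

lemma convex_combination_eq_upper_bound:
  fixes u p :: "'a \<Rightarrow> real"
  assumes "finite C" "\<forall>w\<in>C. 0 \<le> u w" "sum u C = 1"
    and "\<And>w. w \<in> C \<Longrightarrow> p w \<le> b" "(\<Sum>w\<in>C. u w * p w) = b" "w \<in> C" "u w > 0"
  shows "p w = b"
proof -
  have "(\<Sum>w\<in>C. u w * (b - p w)) = 0"
    using assms(3,5) by (simp add: right_diff_distrib sum_subtractf flip: sum_distrib_right)
  then have "u w * (b - p w) = 0"
    using assms by (subst (asm) sum_nonneg_eq_0_iff) auto
  then show ?thesis
    using assms(7) by simp
qed

section \<open>Thresholding and Brouwer's theorem\<close>

text \<open>For \<open>c \<ge> 0\<close> this moves \<open>t\<close> towards 0 by \<open>c\<close>,
  stopping at 0. The form with \<open>max\<close> makes continuity in \<open>t\<close>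
  immediate.\<close>

definition soft_threshold :: "real \<Rightarrow> real \<Rightarrow> real" where
  "soft_threshold c t = max 0 (t - c) - max 0 (- t - c)"

lemma soft_threshold_gt_0:
  assumes "0 \<le> c" "soft_threshold c t > 0" shows "t > c"
  using assms unfolding soft_threshold_def by linarith

lemma soft_threshold_lt_0:
  assumes "0 \<le> c" "soft_threshold c t < 0" shows "t < - c"
  using assms unfolding soft_threshold_def by linarith

text \<open>At a fixed point of the negated, normalised threshold of \<open>f\<close>, a nonzero
  coordinate of \<open>x\<close> means that the same coordinate of \<open>f x\<close> has passed the
  threshold with the opposite sign.\<close>

lemma antipodal_soft_threshold_fixed_point:
  fixes f :: "real ^ 'n \<Rightarrow> real ^ 'n"
  assumes cont: "continuous_on cross_polytope f"
    and nz: "\<And>x. x \<in> cross_polytope \<Longrightarrow> \<exists>i. \<bar>f x $ i\<bar> = 1"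
    and c: "0 \<le> c" "c < 1"
  obtains x where "(\<Sum>i\<in>UNIV. \<bar>x $ i\<bar>) = 1"
    and "\<And>i. x $ i \<noteq> 0 \<Longrightarrow> sgn (x $ i) * f x $ i < - c"
proof -
  define p where "p = (\<lambda>x i. soft_threshold c (f x $ i))"
  define N where "N = (\<lambda>x. \<Sum>i\<in>UNIV. \<bar>p x i\<bar>)"
  define F :: "real ^ 'n \<Rightarrow> real ^ 'n" where "F = (\<lambda>x. \<chi> i. - p x i / N x)"
  have Npos: "N x > 0" if "x \<in> cross_polytope" for x
  proof -
    obtain i where "\<bar>f x $ i\<bar> = 1" using nz[OF \<open>x \<in> cross_polytope\<close>] by blast
    \<comment> \<open>A coordinate of modulus 1 is left with modulus \<open>1 - c\<close>, positive
      since \<open>c < 1\<close>.\<close>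
    then have "\<bar>p x i\<bar> > 0"
      using c unfolding p_def soft_threshold_def by (auto simp: max_def)
    then show ?thesis
      unfolding N_def by (intro sum_pos2[of _ i]) auto
  qed
  have F_norm: "(\<Sum>i\<in>UNIV. \<bar>F x $ i\<bar>) = 1" if "x \<in> cross_polytope" for x
    using Npos[OF that] by (simp add: F_def N_def flip: sum_divide_distrib)
  have contp: "continuous_on cross_polytope (\<lambda>x. p x i)" for i
    unfolding p_def soft_threshold_def by (intro continuous_intros cont)
  have "continuous_on cross_polytope F"
    unfolding F_def using Npos unfolding N_def
    by (intro continuous_on_vec_lambda continuous_intros contp) force
  moreover have "F \<in> cross_polytope \<rightarrow> cross_polytope"
    using F_norm unfolding cross_polytope_def by auto
  moreover have "cross_polytope \<noteq> ({} :: (real ^ 'n) set)"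
    unfolding cross_polytope_def by (auto intro: exI[of _ 0])
  ultimately obtain x where x: "x \<in> cross_polytope" "F x = x"
    using brouwer[OF compact_cross_polytope convex_cross_polytope] by metis
  show ?thesis
  proof (rule that)
    show "(\<Sum>i\<in>UNIV. \<bar>x $ i\<bar>) = 1"
      using F_norm[OF x(1)] x(2) by simp
  next
    fix i assume i: "x $ i \<noteq> 0"
    have xi: "x $ i = - p x i / N x"
      using x(2) by (metis F_def vec_lambda_beta)
    show "sgn (x $ i) * f x $ i < - c"
    proof (cases "x $ i > 0")
      case True
      then have "p x i < 0"
        using xi Npos[OF x(1)] by (simp add: field_simps)
      then show ?thesis
        using True soft_threshold_lt_0[OF c(1)] unfolding p_def by simp
    next
      case False
      then have "p x i > 0"
        using xi i Npos[OF x(1)] by (smt (verit) divide_nonneg_pos)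
      then show ?thesis
        using False i soft_threshold_gt_0[OF c(1)] unfolding p_def by (simp add: sgn_if)
    qed
  qed
qed

section \<open>Sign conditions on labels\<close>

lemma label_agrees_on_support:
  fixes x w y :: "real ^ 'n"
  assumes y: "y \<in> sign_vectors" and x: "(\<Sum>i\<in>UNIV. \<bar>x $ i\<bar>) = 1"
    and w: "\<And>v. v \<in> sign_vectors \<Longrightarrow> v \<bullet> x = 1 \<Longrightarrow> y \<noteq> - v"
  obtains i where "x $ i \<noteq> 0" "sgn (x $ i) * y $ i = 1"
proof -
  \<comment> \<open>On the support of \<open>x\<close>, \<open>v \<bullet> x = 1\<close> forces the
    signs of \<open>x\<close>. Off it \<open>v\<close> is free and is set to \<open>- y\<close>, so
    that \<open>y\<close> and \<open>- v\<close> can differ only on the support.\<close>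
  define v :: "real ^ 'n" where "v = (\<chi> i. if x $ i = 0 then - y $ i else sgn (x $ i))"
  have "v \<in> sign_vectors"
    using y unfolding sign_vectors_def v_def by (auto simp: sgn_if)
  moreover have "v $ i * x $ i = \<bar>x $ i\<bar>" for i
    unfolding v_def by (auto simp: sgn_if)
  then have "v \<bullet> x = 1"
    using x by (simp add: inner_vec_def)
  ultimately have "y \<noteq> - v" by (rule w)
  then obtain i where i: "y $ i \<noteq> - v $ i"
    by (auto simp: vec_eq_iff)
  show ?thesis
  proof (rule that)
    show nz: "x $ i \<noteq> 0"
      using i unfolding v_def by auto
    have "y $ i = -1 \<or> y $ i = 1"
      using y unfolding sign_vectors_def by blast
    then show "sgn (x $ i) * y $ i = 1"
      using i nz unfolding v_def by (auto simp: sgn_if split: if_splits)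
  qed
qed

lemma nonneutral_constant_coordinate:
  assumes "\<not> neutral l S" "\<And>w. w \<in> simplex_vertices S \<Longrightarrow> l w \<in> sign_vectors"
  obtains i c where "\<bar>c\<bar> = 1" "\<And>w. w \<in> simplex_vertices S \<Longrightarrow> l w $ i = c"
proof -
  obtain i where i: "\<And>v1 v2. v1 \<in> simplex_vertices S \<Longrightarrow> v2 \<in> simplex_vertices S \<Longrightarrow>
      \<not> (l v1 $ i = -1 \<and> l v2 $ i = 1)"
    using assms(1) unfolding neutral_def by blast
  have pm: "l w $ i = -1 \<or> l w $ i = 1" if "w \<in> simplex_vertices S" for w
    using assms(2)[OF that] unfolding sign_vectors_def by blast
  show ?thesis
  proof (cases "\<exists>w \<in> simplex_vertices S. l w $ i = 1")
    case True
    then show ?thesis using that[of 1 i] i pm by fastforce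
  next
    \<comment> \<open>A simplex without vertices also falls here, where the claim is
      vacuous.\<close>
    case False
    then show ?thesis using that[of "-1" i] pm by fastforce
  qed
qed

section \<open>Contradiction at the antipodal point\<close>

theorem mainTheorem1:
  fixes T :: "(real ^ 'n) set set"
    and l :: "real ^ 'n \<Rightarrow> real ^ 'n"
  assumes "T triangulates cross_polytope"
    and "\<And>x. x \<in> complex_vertices T \<Longrightarrow> l x \<in> sign_vectors"
    and "\<And>x v. x \<in> complex_vertices T \<Longrightarrow> v \<in> sign_vectors \<Longrightarrow> v \<bullet> x = 1 \<Longrightarrow> l x \<noteq> - v"
  shows "\<exists>S\<in>T. neutral l S"
proof (rule ccontr)
  assume no_neutral: "\<not> (\<exists>S\<in>T. neutral l S)"
  let ?V = simplex_vertices
  have T: "simplicial_complex T" and UT: "\<Union>T = cross_polytope"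
    using assms(1) unfolding triangulates_def by auto
  have VT: "w \<in> complex_vertices T" if "S \<in> T" "w \<in> ?V S" for S w
    using simplex_vertices_subset[OF assms(1)] that by blast
  have fin: "finite (?V S)" if "S \<in> T" for S
    using simplicial_complex_simplex_vertices(1)[OF T that] aff_independent_finite by blast
  obtain f where fcont: "continuous_on cross_polytope f"
    and f: "\<And>S u. S \<in> T \<Longrightarrow> \<forall>v\<in>?V S. 0 \<le> u v \<Longrightarrow> sum u (?V S) = 1 \<Longrightarrow>
           f (\<Sum>v\<in>?V S. u v *\<^sub>R v) = (\<Sum>v\<in>?V S. u v *\<^sub>R l v)"
    using simplicial_interpolation[OF T, of l] unfolding UT by blast
  \<comment> \<open>\<open>S\<close> need not be the smallest simplex containing \<open>x\<close>,
    so some weights may be 0.\<close>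
  have carrier: "\<exists>S u. S \<in> T \<and> (\<forall>v\<in>?V S. 0 \<le> u v) \<and> sum u (?V S) = 1 \<and>
      x = (\<Sum>v\<in>?V S. u v *\<^sub>R v) \<and> f x = (\<Sum>v\<in>?V S. u v *\<^sub>R l v)" if x: "x \<in> cross_polytope" for x
  proof -
    obtain S where S: "S \<in> T" "x \<in> S" using x UT by blast
    obtain u where "\<forall>v\<in>?V S. 0 \<le> u v" "sum u (?V S) = 1" "(\<Sum>v\<in>?V S. u v *\<^sub>R v) = x"
      using simplex_convex_combination[OF T S] by metis
    then show ?thesis
      using S(1) f by blast
  qed
  have bd: "\<exists>i. \<bar>f x $ i\<bar> = 1" if "x \<in> cross_polytope" for x
  proof -
    obtain S u where S: "S \<in> T" and u: "sum u (?V S) = 1" "f x = (\<Sum>v\<in>?V S. u v *\<^sub>R l v)"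
      using carrier[OF \<open>x \<in> cross_polytope\<close>] by blast
    obtain i c where ic: "\<bar>c\<bar> = 1" "\<And>w. w \<in> ?V S \<Longrightarrow> l w $ i = c"
      using nonneutral_constant_coordinate[of l S] no_neutral S assms(2)[OF VT[OF S]] by metis
    have "f x $ i = (\<Sum>w\<in>?V S. u w * c)"
      using ic(2) by (simp add: u(2))
    then show ?thesis
      using ic(1) u(1) by (auto simp flip: sum_distrib_right)
  qed
  define n where "n = real CARD('n)"
  have n: "n \<ge> 1"
    unfolding n_def by (metis One_nat_def Suc_leI of_nat_1 of_nat_mono zero_less_card_finite)
  \<comment> \<open>The threshold \<open>1 - 1 / n\<close> is below 1, as Brouwer's argument needs,
    yet loses at most 1 in total over at most \<open>n\<close> coordinates.\<close>
  obtain x where x1: "(\<Sum>i\<in>UNIV. \<bar>x $ i\<bar>) = 1"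
    and xf: "\<And>i. x $ i \<noteq> 0 \<Longrightarrow> sgn (x $ i) * f x $ i < - (1 - 1 / n)"
    using antipodal_soft_threshold_fixed_point[OF fcont bd, of "1 - 1 / n"] n
    by (auto simp: field_simps)
  then have x: "x \<in> cross_polytope" by (simp add: cross_polytope_def)
  obtain S u where S: "S \<in> T" and u: "\<forall>v\<in>?V S. 0 \<le> u v" "sum u (?V S) = 1"
    "x = (\<Sum>v\<in>?V S. u v *\<^sub>R v)" "f x = (\<Sum>v\<in>?V S. u v *\<^sub>R l v)"
    using carrier[OF x] by blast
  define A where "A = {i. x $ i \<noteq> 0}"
  define s where "s = (\<lambda>i. sgn (x $ i))"
  \<comment> \<open>For positive weight one summand is 1 and the other \<open>card A - 1\<close> are
    at least -1. The factor \<open>u w\<close> makes the bound trivial at vertices of weight 0, to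
    which the boundary condition at \<open>x\<close> does not carry over.\<close>
  have w_bound: "u w * (\<Sum>i\<in>A. s i * l w $ i) \<ge> u w * (2 - real (card A))" if w: "w \<in> ?V S" for w
  proof (cases "u w = 0")
    case False
    then have uw: "u w > 0" using u(1) w by force
    have lw: "l w \<in> sign_vectors" using assms(2)[OF VT[OF S w]] .
    have cp: "w' \<in> cross_polytope" if "w' \<in> ?V S" for w'
      using that S UT unfolding simplex_vertices_def extreme_point_of_def by blast
    have "l w \<noteq> - v" if v: "v \<in> sign_vectors" "v \<bullet> x = 1" for v
    proof (rule assms(3)[OF VT[OF S w] v(1)])
      show "v \<bullet> w = 1"
      proof (rule convex_combination_eq_upper_bound[OF fin[OF S] u(1,2) _ _ w uw])
        show "v \<bullet> w' \<le> 1" if "w' \<in> ?V S" for w'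
          using sign_vector_inner_le_1[OF v(1) cp[OF that]] .
        show "(\<Sum>w\<in>?V S. u w * (v \<bullet> w)) = 1"
          using v(2) by (simp add: u(3) inner_sum_right)
      qed
    qed
    then obtain i where i: "x $ i \<noteq> 0" "sgn (x $ i) * l w $ i = 1"
      using label_agrees_on_support[OF lw x1] by metis
    have ge: "s j * l w $ j \<ge> -1" for j
      using lw unfolding sign_vectors_def s_def by (auto simp: sgn_if dest: spec[of _ j])
    have iA: "i \<in> A" using i(1) by (simp add: A_def)
    have "(\<Sum>j\<in>A - {i}. s j * l w $ j) \<ge> (\<Sum>j\<in>A - {i}. - 1)"
      by (intro sum_mono ge)
    moreover have "(\<Sum>j\<in>A. s j * l w $ j) = 1 + (\<Sum>j\<in>A - {i}. s j * l w $ j)"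
      using i(2) iA by (subst sum.remove[of A i]) (auto simp: s_def)
    moreover have "real (card A) = 1 + real (card (A - {i}))"
      using iA by (subst card.remove[of A i]) auto
    ultimately have "(\<Sum>j\<in>A. s j * l w $ j) \<ge> 2 - real (card A)"
      by simp
    then show ?thesis using uw by simp
  qed simp
  have "(\<Sum>i\<in>A. s i * f x $ i) = (\<Sum>i\<in>A. \<Sum>w\<in>?V S. u w * (s i * l w $ i))"
    by (simp add: u(4) sum_distrib_left mult.left_commute)
  also have "\<dots> = (\<Sum>w\<in>?V S. u w * (\<Sum>i\<in>A. s i * l w $ i))"
    by (subst sum.swap) (simp add: sum_distrib_left)
  also have "\<dots> \<ge> (\<Sum>w\<in>?V S. u w * (2 - real (card A)))"
    by (intro sum_mono w_bound)
  finally have lower: "(\<Sum>i\<in>A. s i * f x $ i) \<ge> 2 - real (card A)"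
    using u(2) by (simp flip: sum_distrib_right)
  \<comment> \<open>Since \<open>card A \<le> n\<close>, this sum is at most
    \<open>1 - card A\<close>, one less than the lower bound.\<close>
  have "(\<Sum>i\<in>A. s i * f x $ i) \<le> (\<Sum>i\<in>A. - (1 - 1 / n))"
    using xf by (intro sum_mono less_imp_le) (auto simp: s_def A_def)
  also have "\<dots> = real (card A) / n - real (card A)"
    by (simp add: algebra_simps)
  also have "\<dots> \<le> 1 - real (card A)"
    using n card_mono[of UNIV A] by (simp add: n_def)
  finally show False
    using lower by simp
qed

end
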